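(* Let $n\ge3$. Then there exist $t_0>0$ and positive constants $C_{1,n},C_{2,n}$ depending only on $n$ such that for all $t\ge t_0$, $$C_{1,n}\,t^{-\frac{n-2}{2}}\le\int_{\mathbf{R}^n}\frac{(1+|\xi|^2)^{-t}\sin^2\left(t\sqrt{\log(1+|\xi|^2)}\right)}{\log(1+|\xi|^2)}\,d\xi\le C_{2,n}\,t^{-\frac{n-2}{2}}.$$ *)

theory Defs
  imports "HOL-Analysis.Analysis"
begin

end

theory Submission imports Defs begin

text \<open>
  Write d for the dimension. Since 1 / ln (1 + u) <= (1 + u) / u, the integrand is at most
  |x|^(-2) (1 + |x|^2)^(1 - t). As |x| dominates every coordinate, this is bounded by a product
  over the coordinates of |s|^(-2/d) / (1 + a s^2) with a = (t - 1) / d, each factor being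
  integrable because 2/d < 1; scaling yields the power of t.

  For the lower bound, take a cube of side t^(-1/2) at distance of order t^(-1/2) from the
  origin. A translation by a small multiple of 1 / t in every coordinate moves the phase
  t sqrt (ln (1 + |x|^2)) by an amount between two positive constants below pi, so the squared
  sines at x and at the translate cannot both be small. By translation invariance, twice the
  integral is at least a constant times t times the volume of the cube.
\<close>

section \<open>Elementary inequalities for logarithms and powers\<close>

lemma ln_one_plus_ge:
  fixes x :: real
  assumes "0 \<le> x"
  shows "x / (1 + x) \<le> ln (1 + x)"
proof -
  have "ln (1 / (1 + x)) \<le> 1 / (1 + x) - 1"
    using assms by (intro ln_le_minus_one) auto
  moreover have "1 - 1 / (1 + x) = x / (1 + x)"
    using assms by (simp add: field_simps)
  ultimately show ?thesis
    using assms by (simp add: ln_div)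
qed

text \<open>Concavity of \<open>ln\<close>: the point 1 + x is the convex combination of 1 and 1 + a
  x with weights 1 - 1/a and 1/a. This later trades a power of 1 + |x|^2 for a quadratic
  denominator.\<close>

lemma Bernoulli_inequality_powr:
  fixes x a :: real
  assumes "0 \<le> x" "1 \<le> a"
  shows "1 + a * x \<le> (1 + x) powr a"
proof -
  have "(1 - 1 / a) * ln 1 + 1 / a * ln (1 + a * x) \<le> ln ((1 - 1 / a) *\<^sub>R 1 + (1 / a) *\<^sub>R (1 + a * x))"
    using assms by (intro concave_onD[OF ln_concave]) (auto simp: add_pos_nonneg)
  also have "(1 - 1 / a) *\<^sub>R 1 + (1 / a) *\<^sub>R (1 + a * x) = 1 + x"
    using assms by (simp add: field_simps)
  finally have "ln (1 + a * x) \<le> a * ln (1 + x)"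
    using assms by (simp add: field_simps)
  then have "exp (ln (1 + a * x)) \<le> exp (a * ln (1 + x))"
    by simp
  then show ?thesis
    using assms by (simp add: powr_def add_pos_nonneg)
qed

section \<open>The one-dimensional majorant and its scaling\<close>

text \<open>On [0, 1] the power s^(-p) dominates and is integrable because p < 1; beyond 1 the power
  is at most 1 and 1 / (1 + s^2) dominates. The negative half-line follows by reflection.\<close>

lemma nn_integral_powr_over_quadratic_finite:
  fixes p :: real
  assumes "0 \<le> p" "p < 1"
  shows "(\<integral>\<^sup>+s. ennreal (\<bar>s\<bar> powr (- p) / (1 + s\<^sup>2)) \<partial>lborel) < \<infinity>"
proof -
  define g where "g s = ennreal (\<bar>s\<bar> powr (- p) / (1 + s\<^sup>2)) * indicator {0..} s" for s :: real
  have [measurable]: "g \<in> borel_measurable borel"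
    unfolding g_def by measurable
  define u where "u s = (if s \<in> {0..1} then s powr (- p) else 0)" for s :: real
  have u_meas [measurable]: "u \<in> borel_measurable borel"
    unfolding u_def by measurable
  have "((\<lambda>s. s powr (- p)) has_integral (1 powr (- p + 1) / (- p + 1))) {0..1}"
    using assms by (intro has_integral_powr_from_0) auto
  then have "(u has_integral (1 powr (- p + 1) / (- p + 1))) UNIV"
    unfolding u_def by (subst has_integral_restrict_UNIV)
  then have u: "(\<integral>\<^sup>+s. ennreal (u s) \<partial>lborel) < \<infinity>"
    by (subst nn_integral_has_integral_lborel[OF u_meas]) (auto simp: u_def)
  have at: "(\<integral>\<^sup>+s. ennreal (1 / (1 + s\<^sup>2)) * indicator {0..} s \<partial>lborel) = ennreal (pi / 2 - arctan 0)"
    by (intro nn_integral_FTC_atLeast)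
       (auto intro!: derivative_eq_intros tendsto_arctan_at_top simp: field_simps)
  have le: "g s \<le> ennreal (u s) + ennreal (1 / (1 + s\<^sup>2)) * indicator {0..} s" for s
  proof (cases "s \<ge> 0")
    case True
    have "\<bar>s\<bar> powr (- p) / (1 + s\<^sup>2) \<le> u s + 1 / (1 + s\<^sup>2)"
    proof (cases "s \<le> 1")
      case s: True
      have "\<bar>s\<bar> powr (- p) / (1 + s\<^sup>2) \<le> \<bar>s\<bar> powr (- p) / 1"
        by (intro divide_left_mono) (auto simp: add_pos_nonneg)
      then show ?thesis using True s by (simp add: u_def add_increasing2)
    next
      case False
      then have "\<bar>s\<bar> powr (- p) \<le> 1"
        using assms by (simp add: powr_minus ge_one_powr_ge_zero inverse_le_1_iff)
      then show ?thesis using False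
        by (simp add: u_def divide_right_mono)
    qed
    then have "ennreal (\<bar>s\<bar> powr (- p) / (1 + s\<^sup>2)) \<le> ennreal (u s + 1 / (1 + s\<^sup>2))"
      by (rule ennreal_leI)
    also have "\<dots> = ennreal (u s) + ennreal (1 / (1 + s\<^sup>2))"
      by (intro ennreal_plus) (auto simp: u_def)
    finally show ?thesis using True by (simp add: g_def)
  qed (simp add: g_def)
  have "(\<integral>\<^sup>+s. g s \<partial>lborel)
      \<le> (\<integral>\<^sup>+s. ennreal (u s) + ennreal (1 / (1 + s\<^sup>2)) * indicator {0..} s \<partial>lborel)"
    by (intro nn_integral_mono le)
  also have "\<dots> = (\<integral>\<^sup>+s. ennreal (u s) \<partial>lborel)
      + (\<integral>\<^sup>+s. ennreal (1 / (1 + s\<^sup>2)) * indicator {0..} s \<partial>lborel)"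
    by (intro nn_integral_add) auto
  also have "\<dots> < \<infinity>"
    using u unfolding at by (simp add: ennreal_add_eq_top less_top)
  finally have g: "(\<integral>\<^sup>+s. g s \<partial>lborel) < \<infinity>" .
  \<comment> \<open>The integrand is even, so \<open>g\<close> and its reflection together cover the
    line and have equal integrals.\<close>
  have "(\<integral>\<^sup>+s. g s \<partial>lborel) = (\<integral>\<^sup>+s. g (- s) \<partial>lborel)"
    using nn_integral_real_affine[of g "-1" 0] by simp
  moreover have "(\<integral>\<^sup>+s. ennreal (\<bar>s\<bar> powr (- p) / (1 + s\<^sup>2)) \<partial>lborel)
      \<le> (\<integral>\<^sup>+s. g s + g (- s) \<partial>lborel)"
    by (intro nn_integral_mono) (auto simp: g_def indicator_def)
  moreover have "(\<integral>\<^sup>+s. g s + g (- s) \<partial>lborel) = (\<integral>\<^sup>+s. g s \<partial>lborel) + (\<integral>\<^sup>+s. g (- s) \<partial>lborel)"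
    by (intro nn_integral_add) auto
  ultimately show ?thesis
    using g by (metis ennreal_add_less_top infinity_ennreal_def order_le_less_trans)
qed

text \<open>Substituting c s with c = a^(-1/2) turns a s^2 into s^2; the Jacobian c and the
  homogeneity factor c^(-p) combine to the power of a. For p = 2/d, a product of d such factors
  gives a^(-(d - 2)/2).\<close>

lemma nn_integral_powr_over_quadratic_scale:
  fixes p a :: real
  assumes "0 < a"
  shows "(\<integral>\<^sup>+s. ennreal (\<bar>s\<bar> powr (- p) / (1 + a * s\<^sup>2)) \<partial>lborel)
    = ennreal (a powr ((p - 1) / 2)) * (\<integral>\<^sup>+s. ennreal (\<bar>s\<bar> powr (- p) / (1 + s\<^sup>2)) \<partial>lborel)"
proof -
  define c where "c = a powr (- 1 / 2)"
  have "c\<^sup>2 = a powr (- 1 / 2 + - 1 / 2)"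
    unfolding c_def powr_add power2_eq_square ..
  then have c: "0 < c" "a * c\<^sup>2 = 1"
    using assms by (auto simp: c_def powr_minus)
  have cp: "c powr (- p) * c = a powr ((p - 1) / 2)"
    unfolding c_def powr_powr powr_add[symmetric] by (simp add: diff_divide_distrib)
  \<comment> \<open>The summand 0 matches the affine substitution in
    \<open>nn_integral_real_affine\<close>.\<close>
  have eq: "\<bar>0 + c * s\<bar> powr (- p) / (1 + a * (0 + c * s)\<^sup>2)
      = c powr (- p) * (\<bar>s\<bar> powr (- p) / (1 + s\<^sup>2))" for s
  proof -
    have "a * (0 + c * s)\<^sup>2 = s\<^sup>2"
      using c(2) by (simp add: power_mult_distrib flip: mult.assoc)
    then show ?thesis using c(1) by (simp add: abs_mult powr_mult)
  qed
  have "(\<integral>\<^sup>+s. ennreal (\<bar>s\<bar> powr (- p) / (1 + a * s\<^sup>2)) \<partial>lborel)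
     = ennreal \<bar>c\<bar> * (\<integral>\<^sup>+s. ennreal (\<bar>0 + c * s\<bar> powr (- p) / (1 + a * (0 + c * s)\<^sup>2)) \<partial>lborel)"
    using c by (intro nn_integral_real_affine) auto
  also have "\<dots> = ennreal \<bar>c\<bar> * (\<integral>\<^sup>+s. ennreal (c powr (- p)) * ennreal (\<bar>s\<bar> powr (- p) / (1 + s\<^sup>2)) \<partial>lborel)"
    unfolding eq by (subst ennreal_mult) auto
  also have "\<dots> = ennreal \<bar>c\<bar> * (ennreal (c powr (- p)) * (\<integral>\<^sup>+s. ennreal (\<bar>s\<bar> powr (- p) / (1 + s\<^sup>2)) \<partial>lborel))"
    by (subst nn_integral_cmult) auto
  also have "\<dots> = ennreal (c powr (- p) * c) * (\<integral>\<^sup>+s. ennreal (\<bar>s\<bar> powr (- p) / (1 + s\<^sup>2)) \<partial>lborel)"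
    using c by (simp add: ennreal_mult mult_ac)
  finally show ?thesis unfolding cp .
qed

section \<open>Change of phase under a small translation\<close>

text \<open>The addition formula bounds |sin (y - x)| by |sin x| + |sin y|; squaring costs the
  factor 2.\<close>

lemma sin_squared_shift_ge:
  fixes x y :: real
  shows "(sin (y - x))\<^sup>2 / 2 \<le> (sin x)\<^sup>2 + (sin y)\<^sup>2"
proof -
  have "\<bar>sin (y - x)\<bar> \<le> \<bar>sin y * cos x\<bar> + \<bar>cos y * sin x\<bar>"
    by (simp add: sin_diff)
  also have "\<dots> \<le> \<bar>sin y\<bar> + \<bar>sin x\<bar>"
    unfolding abs_mult by (intro add_mono mult_left_le mult_left_le_one_le) auto
  finally have "(sin (y - x))\<^sup>2 \<le> (\<bar>sin y\<bar> + \<bar>sin x\<bar>)\<^sup>2"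
    by (simp add: abs_le_square_iff[symmetric])
  also have "\<dots> \<le> 2 * ((sin x)\<^sup>2 + (sin y)\<^sup>2)"
    using sum_squares_bound[of "\<bar>sin x\<bar>" "\<bar>sin y\<bar>"] by (simp add: power2_sum algebra_simps)
  finally show ?thesis by simp
qed

text \<open>Here s stands for t^(-1/2), and N, M for the squared norms of a point and its translate,
  so \<open>D\<close> is the change of phase. The two logarithms differ by order s^3, their square
  roots have order s, hence the roots differ by order s^2, which the factor 1 / s^2 cancels.\<close>

lemma phase_increment_bounds:
  fixes d s N M :: real
  assumes d: "2 \<le> d" and s: "0 < s" and ds1: "9 * d * s\<^sup>2 \<le> 1"
    and N: "d * s\<^sup>2 \<le> N" "N \<le> 4 * d * s\<^sup>2"
    and M: "N + s ^ 3 / 2 \<le> M" "M \<le> N + 5 / 4 * s ^ 3"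
  defines "D \<equiv> (sqrt (ln (1 + M)) - sqrt (ln (1 + N))) / s\<^sup>2"
  shows "1 / (24 * d) \<le> D" "D \<le> 1"
proof -
  define L where "L = ln (1 + N)"
  define L' where "L' = ln (1 + M)"
  have s2: "0 < s\<^sup>2" and s3: "0 < s ^ 3" using assms by auto
  have ds: "2 * s\<^sup>2 \<le> d * s\<^sup>2" using assms by (intro mult_right_mono) auto
  have "s\<^sup>2 \<le> 1" using ds assms s2 by linarith
  then have s1: "s \<le> 1" using assms by (intro power2_le_imp_le[of s 1]) auto
  have s32: "s ^ 3 \<le> s\<^sup>2" using assms s1 by (simp add: power_decreasing)
  have N0: "0 < N" using N ds s2 by linarith
  have NM: "N < M" using M s3 by linarith
  have M9: "M \<le> 9 * d * s\<^sup>2" using M N s32 ds s2 by linarith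
  have M1: "M \<le> 1" using M9 assms by linarith
  have diff: "L' - L = ln ((1 + M) / (1 + N))"
    using N0 NM by (simp add: L_def L'_def ln_div)
  have "L' - L \<le> (1 + M) / (1 + N) - 1"
    unfolding diff using N0 NM by (intro ln_le_minus_one) auto
  also have "\<dots> = (M - N) / (1 + N)" using N0 by (simp add: field_simps)
  also have "\<dots> \<le> (M - N) / 1" using N0 NM by (intro divide_left_mono) auto
  finally have up: "L' - L \<le> 5 / 4 * s ^ 3" using M by simp
  \<comment> \<open>The smallness of s gave M <= 1. The quotient is then put in the form z / (1 + z)
    with z = (M - N) / (1 + N), to which \<open>ln_one_plus_ge\<close> applies.\<close>
  have "(M - N) / 2 \<le> (M - N) / (1 + M)"
    using M1 N0 NM by (intro divide_left_mono) auto
  also have "\<dots> = ((M - N) / (1 + N)) / ((1 + M) / (1 + N))"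
    using N0 NM by simp
  also have quot: "(1 + M) / (1 + N) = 1 + (M - N) / (1 + N)"
    using N0 by (simp add: field_simps)
  also have "(M - N) / (1 + N) / (1 + (M - N) / (1 + N)) \<le> ln (1 + (M - N) / (1 + N))"
    using N0 NM by (intro ln_one_plus_ge) auto
  also note quot[symmetric]
  finally have lo: "s ^ 3 / 4 \<le> L' - L" using diff M by simp
  have "N / 2 \<le> N / (1 + N)" using N0 NM M1 by (intro divide_left_mono) auto
  also have "\<dots> \<le> L" unfolding L_def using N0 by (intro ln_one_plus_ge) auto
  finally have "s\<^sup>2 \<le> L" using N ds by linarith
  then have Ls: "s \<le> sqrt L" using assms by (simp add: real_le_rsqrt)
  have LL: "sqrt L \<le> sqrt L'" using lo s3 by (intro real_sqrt_le_mono) linarith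
  have "L' \<le> M" unfolding L'_def using N0 NM by (intro ln_add_one_self_le_self) auto
  also have "\<dots> \<le> 9 * d * s\<^sup>2" by fact
  \<comment> \<open>Replacing d by d^2 is crude, but avoids sqrt d in the constants.\<close>
  also have "\<dots> \<le> (3 * d * s)\<^sup>2"
  proof -
    have "9 * d * 1 * s\<^sup>2 \<le> 9 * d * d * s\<^sup>2"
      using assms by (intro mult_right_mono mult_left_mono) auto
    then show ?thesis by (simp add: power_mult_distrib power2_eq_square mult_ac)
  qed
  finally have L'd: "sqrt L' \<le> 3 * d * s"
    using assms by (intro real_le_lsqrt) auto
  have pos: "0 < sqrt L + sqrt L'" "0 < L" "0 < L'"
    using Ls LL assms \<open>s\<^sup>2 \<le> L\<close> s2 lo s3 by linarith+
  \<comment> \<open>Rationalising the difference of square roots.\<close>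
  have D: "D = (L' - L) / (sqrt L + sqrt L') / s\<^sup>2"
  proof -
    have "(sqrt L' - sqrt L) * (sqrt L + sqrt L') = L' - L"
      using pos by (simp add: algebra_simps)
    then show ?thesis
      using pos by (simp add: D_def L_def[symmetric] L'_def[symmetric] eq_divide_eq)
  qed
  have "2 * s \<le> sqrt L + sqrt L'" using Ls LL by linarith
  then have "D \<le> (5 / 4 * s ^ 3) / (2 * s) / s\<^sup>2"
    unfolding D using up s s3 by (intro divide_right_mono frac_le) auto
  also have "\<dots> = 5 / 8" using assms by (simp add: field_simps power2_eq_square power3_eq_cube)
  finally show "D \<le> 1" by simp
  \<comment> \<open>24 d = 4 * 6 d: the logarithms differ by at least s^3 / 4, and each root is at
    most 3 d s.\<close>
  have "1 / (24 * d) = (s ^ 3 / 4) / (6 * d * s) / s\<^sup>2"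
    using assms by (simp add: field_simps power2_eq_square power3_eq_cube)
  also have "\<dots> \<le> D"
    unfolding D using lo L'd LL pos s2 s3 by (intro divide_right_mono frac_le) linarith+
  finally show "1 / (24 * d) \<le> D" .
qed

section \<open>The integrand\<close>

text \<open>Division by \<open>ln 1\<close> makes the value at the origin 0 instead of the limit
  t^2; this affects only a null set.\<close>

definition damped_oscillation :: "real \<Rightarrow> 'a::euclidean_space \<Rightarrow> real" where
  "damped_oscillation t \<xi> = (1 + (norm \<xi>)\<^sup>2) powr (- t)
     * (sin (t * sqrt (ln (1 + (norm \<xi>)\<^sup>2))))\<^sup>2 / ln (1 + (norm \<xi>)\<^sup>2)"

lemma damped_oscillation_nonneg: "0 \<le> damped_oscillation t \<xi>"
  unfolding damped_oscillation_def by (intro divide_nonneg_nonneg mult_nonneg_nonneg) auto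

lemma borel_measurable_damped_oscillation [measurable]:
  "damped_oscillation t \<in> borel_measurable borel"
  unfolding damped_oscillation_def by measurable

section \<open>Upper bound\<close>

text \<open>The radial majorant is a perfect d-th power, so one factor can be given to each
  coordinate. Coordinates must be nonzero because \<open>powr\<close> sends base 0 to 0, which would
  make the product vanish.\<close>

lemma damped_oscillation_le_prod:
  fixes x :: "'a::euclidean_space"
  assumes t: "real DIM('a) + 1 \<le> t" and nz: "\<And>b. b \<in> Basis \<Longrightarrow> x \<bullet> b \<noteq> 0"
  shows "damped_oscillation t x
    \<le> (\<Prod>b\<in>Basis. \<bar>x \<bullet> b\<bar> powr (- (2 / real DIM('a)))
          / (1 + (t - 1) / real DIM('a) * (x \<bullet> b)\<^sup>2))"
proof -
  define d where "d = real DIM('a)"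
  define a where "a = (t - 1) / d"
  define r where "r = norm x"
  have d: "0 < d" unfolding d_def by simp
  have a: "1 \<le> a" using t d unfolding a_def d_def by simp
  have r: "0 < r" using nz nonempty_Basis unfolding r_def by force
  have r2: "1 + r\<^sup>2 > 0" by (simp add: add_pos_nonneg)
  have "r\<^sup>2 / (1 + r\<^sup>2) \<le> ln (1 + r\<^sup>2)"
    by (intro ln_one_plus_ge) auto
  then have "1 / ln (1 + r\<^sup>2) \<le> 1 / (r\<^sup>2 / (1 + r\<^sup>2))"
    using r r2 by (intro divide_left_mono mult_pos_pos) (auto simp: ln_gt_zero)
  then have inv: "1 / ln (1 + r\<^sup>2) \<le> (1 + r\<^sup>2) * r powr (- 2)"
    using r by (simp add: powr_minus field_simps)
  have "damped_oscillation t x \<le> (1 + r\<^sup>2) powr (- t) * 1 * (1 / ln (1 + r\<^sup>2))"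
    unfolding damped_oscillation_def r_def[symmetric]
    by (simp add: divide_right_mono mult_left_le abs_square_le_1)
  also have "\<dots> \<le> (1 + r\<^sup>2) powr (- t) * 1 * ((1 + r\<^sup>2) * r powr (- 2))"
    using inv by (intro mult_left_mono) auto
  \<comment> \<open>The exponents are r^(-2) and 1 - t = - a d, divided equally among d
    factors.\<close>
  also have "\<dots> = (r powr (- (2 / d)) * (1 + r\<^sup>2) powr (- a)) ^ DIM('a)"
  proof -
    have "(r powr (- (2 / d)) * (1 + r\<^sup>2) powr (- a)) ^ DIM('a)
        = (r powr (- (2 / d)) * (1 + r\<^sup>2) powr (- a)) powr d"
      using r r2 unfolding d_def by (subst powr_realpow) auto
    also have "\<dots> = r powr (- 2) * (1 + r\<^sup>2) powr (1 - t)"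
      using d by (simp add: powr_mult powr_powr a_def)
    also have "(1 + r\<^sup>2) powr (1 - t) = (1 + r\<^sup>2) * (1 + r\<^sup>2) powr (- t)"
      using r2 powr_mult_base[of "1 + r\<^sup>2" "- t"] by simp
    finally show ?thesis by (simp add: mult_ac)
  qed
  also have "\<dots> = (\<Prod>b\<in>(Basis::'a set). r powr (- (2 / d)) * (1 + r\<^sup>2) powr (- a))"
    by simp
  also have "\<dots> \<le> (\<Prod>b\<in>Basis. \<bar>x \<bullet> b\<bar> powr (- (2 / d)) * (1 / (1 + a * (x \<bullet> b)\<^sup>2)))"
  proof (intro prod_mono conjI mult_mono)
    fix b :: 'a assume b: "b \<in> Basis"
    have xb: "0 < \<bar>x \<bullet> b\<bar>" "\<bar>x \<bullet> b\<bar> \<le> r"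
      using nz[OF b] Basis_le_norm[OF b, of x] unfolding r_def by auto
    then show "r powr (- (2 / d)) \<le> \<bar>x \<bullet> b\<bar> powr (- (2 / d))"
      using d by (intro powr_mono2') auto
    have sq: "(x \<bullet> b)\<^sup>2 \<le> r\<^sup>2" using xb by (metis abs_ge_zero power2_abs power_mono)
    \<comment> \<open>Bernoulli applies since t >= d + 1 gives a >= 1.\<close>
    have "1 + a * (x \<bullet> b)\<^sup>2 \<le> 1 + a * r\<^sup>2"
      using sq a by (simp add: mult_left_mono)
    also have "\<dots> \<le> (1 + r\<^sup>2) powr a"
      using a by (intro Bernoulli_inequality_powr) auto
    finally show "(1 + r\<^sup>2) powr (- a) \<le> 1 / (1 + a * (x \<bullet> b)\<^sup>2)"
      using a unfolding powr_minus_divide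
      by (intro frac_le) (auto simp: add_pos_nonneg)
  qed auto
  finally show ?thesis by (simp add: d_def a_def)
qed

lemma nn_integral_damped_oscillation_upper:
  assumes "3 \<le> DIM('a::euclidean_space)"
  shows "\<exists>C>0. \<forall>t\<ge>real DIM('a) + 1.
    (\<integral>\<^sup>+x. ennreal (damped_oscillation t (x::'a)) \<partial>lborel)
      \<le> ennreal (C * t powr (- ((real DIM('a) - 2) / 2)))"
proof -
  define d where "d = real DIM('a)"
  have d: "3 \<le> d" using assms by (simp add: d_def)
  define e where "e = (d - 2) / 2"
  have e: "0 \<le> e" using d by (simp add: e_def)
  define J where "J = (\<integral>\<^sup>+s. ennreal (\<bar>s\<bar> powr (- (2 / d)) / (1 + s\<^sup>2)) \<partial>lborel)"
  have "J < \<infinity>"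
    unfolding J_def using d by (intro nn_integral_powr_over_quadratic_finite) auto
  then obtain K where K: "0 \<le> K" "J = ennreal K"
    by (cases J) auto
  \<comment> \<open>K + 1 makes the constant positive without a lower bound for K; (2 d)^e pays for
    replacing a by t / (2 d).\<close>
  define C where "C = (K + 1) ^ DIM('a) * (2 * d) powr e"
  have "0 < C" using K d by (simp add: C_def)
  moreover have "(\<integral>\<^sup>+x. ennreal (damped_oscillation t (x::'a)) \<partial>lborel) \<le> ennreal (C * t powr (- e))"
    if t: "real DIM('a) + 1 \<le> t" for t
  proof -
    define a where "a = (t - 1) / d"
    have a: "1 \<le> a" using t d by (simp add: a_def d_def)
    have at: "t / (2 * d) \<le> a" using t d by (simp add: a_def d_def field_simps)
    let ?k = "\<lambda>s. \<bar>s\<bar> powr (- (2 / d)) / (1 + a * s\<^sup>2)"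
    have k0: "0 \<le> ?k s" for s using a by (intro divide_nonneg_nonneg) auto
    \<comment> \<open>The excluded coordinate hyperplanes are null sets.\<close>
    have "AE x::'a in lborel. \<forall>b\<in>Basis. x \<bullet> b \<noteq> 0"
      by (intro AE_finite_allI AE_lborel_inner_neq) auto
    then have "AE x::'a in lborel. ennreal (damped_oscillation t x)
        \<le> (\<Prod>b\<in>Basis. ennreal (?k (x \<bullet> b)))"
    proof eventually_elim
      case (elim x)
      then have "damped_oscillation t x \<le> (\<Prod>b\<in>Basis. ?k (x \<bullet> b))"
        using damped_oscillation_le_prod[OF t, of x] by (simp add: a_def d_def)
      then show ?case
        using k0 by (subst prod_ennreal) (auto intro: ennreal_leI)
    qed
    then have "(\<integral>\<^sup>+x. ennreal (damped_oscillation t (x::'a)) \<partial>lborel)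
        \<le> (\<integral>\<^sup>+x. (\<Prod>b\<in>Basis. ennreal (?k ((x::'a) \<bullet> b))) \<partial>lborel)"
      by (rule nn_integral_mono_AE)
    also have "\<dots> = (\<Prod>b\<in>(Basis::'a set). (\<integral>\<^sup>+s. ennreal (?k s) \<partial>lborel))"
      by (intro nn_integral_lborel_prod) auto
    also have "\<dots> = (\<Prod>b\<in>(Basis::'a set). ennreal (a powr ((2 / d - 1) / 2) * K))"
      using a K by (subst nn_integral_powr_over_quadratic_scale) (auto simp: J_def[symmetric] ennreal_mult)
    also have "\<dots> = ennreal ((a powr ((2 / d - 1) / 2) * K) ^ DIM('a))"
      using K by (simp add: ennreal_power)
    also have "\<dots> \<le> ennreal (C * t powr (- e))"
    proof (rule ennreal_leI)
      have "(a powr ((2 / d - 1) / 2)) ^ DIM('a) = a powr ((2 / d - 1) / 2 * d)"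
        using a by (simp add: powr_powr d_def flip: powr_realpow)
      also have "(2 / d - 1) / 2 * d = - e"
        using d by (simp add: e_def field_simps)
      also have "a powr (- e) \<le> (t / (2 * d)) powr (- e)"
        using at e d t by (intro powr_mono2') auto
      also have "\<dots> = (2 * d) powr e * t powr (- e)"
        using d t by (simp add: powr_divide powr_minus field_simps)
      finally have "(a powr ((2 / d - 1) / 2)) ^ DIM('a) \<le> (2 * d) powr e * t powr (- e)" .
      then have "(a powr ((2 / d - 1) / 2)) ^ DIM('a) * K ^ DIM('a)
          \<le> (2 * d) powr e * t powr (- e) * (K + 1) ^ DIM('a)"
        using K by (intro mult_mono power_mono) auto
      then show "(a powr ((2 / d - 1) / 2) * K) ^ DIM('a) \<le> C * t powr (- e)"
        by (simp add: C_def power_mult_distrib mult_ac)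
    qed
    finally show ?thesis .
  qed
  ultimately show ?thesis unfolding e_def d_def by blast
qed

section \<open>Lower bound\<close>

text \<open>From ln (1 + N) <= N follows t ln (1 + N) <= R. So where |x|^2 <= R / t, the factor
  multiplying the squared sine is at least a constant times t.\<close>

lemma damping_factor_ge:
  fixes N R t :: real
  assumes "0 < N" "t * N \<le> R" "0 < t"
  shows "exp (- R) * t / R \<le> (1 + N) powr (- t) / ln (1 + N)"
proof -
  have ln: "0 < ln (1 + N)" "ln (1 + N) \<le> N"
    using assms ln_add_one_self_le_self[of N] by auto
  have "0 < t * N" using assms by simp
  then have "0 < R" using assms by linarith
  have "t * ln (1 + N) \<le> R"
    using mult_left_mono[OF ln(2), of t] assms by linarith
  then have "exp (- R) \<le> (1 + N) powr (- t)"
    using assms by (simp add: powr_def)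
  moreover have "t / R \<le> t / (t * ln (1 + N))"
    using \<open>t * ln (1 + N) \<le> R\<close> ln assms by (intro frac_le) auto
  then have "t / R \<le> 1 / ln (1 + N)"
    using assms by simp
  ultimately have "exp (- R) * (t / R) \<le> (1 + N) powr (- t) * (1 / ln (1 + N))"
    using \<open>0 < R\<close> assms by (intro mult_mono) auto
  then show ?thesis by simp
qed

text \<open>On the cube the sum of the coordinates of x lies between d s and 2 d s, so translation
  by v raises the squared norm by an amount of order s^3, as \<open>phase_increment_bounds\<close>
  demands. Both points keep t |x|^2 <= 9 d, which bounds the damping.\<close>

lemma damped_oscillation_shift_ge:
  fixes x v :: "'a::euclidean_space" and s :: real
  assumes dim: "2 \<le> DIM('a)" and s: "0 < s" "9 * real DIM('a) * s\<^sup>2 \<le> 1"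
    and x: "x \<in> cbox (s *\<^sub>R One) ((2 * s) *\<^sub>R One)"
    and v: "v = (s\<^sup>2 / (4 * real DIM('a))) *\<^sub>R One"
  defines "d \<equiv> real DIM('a)"
  shows "exp (- (9 * d)) * (1 / s\<^sup>2) / (9 * d) * ((sin (1 / (24 * d)))\<^sup>2 / 2)
     \<le> damped_oscillation (1 / s\<^sup>2) x + damped_oscillation (1 / s\<^sup>2) (v + x)"
proof -
  have d: "2 \<le> d" using dim by (simp add: d_def)
  define N where "N = (norm x)\<^sup>2"
  define M where "M = (norm (v + x))\<^sup>2"
  define t where "t = 1 / s\<^sup>2"
  have s2: "0 < s\<^sup>2" and s3: "0 < s ^ 3" using s by auto
  have t: "0 < t" using s2 by (simp add: t_def)
  have ds: "2 * s\<^sup>2 \<le> d * s\<^sup>2" using d by (intro mult_right_mono) auto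
  then have "s\<^sup>2 \<le> 1\<^sup>2" using s s2 unfolding d_def[symmetric] one_power2 by linarith
  then have s1: "s \<le> 1" by (rule power2_le_imp_le) simp
  have xb: "s \<le> x \<bullet> b" "x \<bullet> b \<le> 2 * s" if "b \<in> Basis" for b
    using x that by (auto simp: mem_box)
  have NN: "N = (\<Sum>b\<in>Basis. (x \<bullet> b)\<^sup>2)"
    unfolding N_def power2_norm_eq_inner by (subst euclidean_inner) (simp add: power2_eq_square)
  have "(\<Sum>b\<in>(Basis::'a set). s\<^sup>2) \<le> N"
    unfolding NN using xb s by (intro sum_mono power_mono) auto
  then have N1: "d * s\<^sup>2 \<le> N" by (simp add: d_def)
  have "N \<le> (\<Sum>b\<in>(Basis::'a set). (2 * s)\<^sup>2)"
    unfolding NN using xb s by (intro sum_mono power_mono) (auto intro: order_trans[OF less_imp_le])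
  then have N2: "N \<le> 4 * d * s\<^sup>2" by (simp add: d_def power_mult_distrib mult_ac)
  define h where "h = One \<bullet> x"
  have hh: "h = (\<Sum>b\<in>Basis. x \<bullet> b)"
    unfolding h_def inner_sum_left by (intro sum.cong refl inner_commute)
  have h1: "d * s \<le> h"
    using sum_mono[of "Basis::'a set" "\<lambda>_. s" "\<lambda>b. x \<bullet> b"] xb by (simp add: hh d_def)
  have h2: "h \<le> 2 * d * s"
    using sum_mono[of "Basis::'a set" "\<lambda>b. x \<bullet> b" "\<lambda>_. 2 * s"] xb by (simp add: hh d_def mult_ac)
  have "M = N + 2 * (v \<bullet> x) + v \<bullet> v"
    unfolding M_def N_def power2_norm_eq_inner by (simp add: inner_add inner_commute)
  also have "v \<bullet> x = s\<^sup>2 / (4 * d) * h" by (simp add: v h_def d_def)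
  also have "v \<bullet> v = (s\<^sup>2 / (4 * d))\<^sup>2 * d"
    by (subst euclidean_inner) (simp add: v d_def power2_eq_square)
  \<comment> \<open>The linear term lies between s^3 / 2 and s^3; the quadratic one is at most s^3 /
    4, whence the constant 5/4.\<close>
  finally have M: "M = N + s\<^sup>2 / (2 * d) * h + s ^ 4 / (16 * d)"
    using d by (simp add: field_simps power2_eq_square power4_eq_xxxx)
  have "s\<^sup>2 / (2 * d) * (d * s) \<le> s\<^sup>2 / (2 * d) * h"
    using h1 d by (intro mult_left_mono) auto
  moreover have "s\<^sup>2 / (2 * d) * (d * s) = s ^ 3 / 2"
    using d by (simp add: field_simps power2_eq_square power3_eq_cube)
  moreover have "0 \<le> s ^ 4 / (16 * d)" using d by simp
  ultimately have M1: "N + s ^ 3 / 2 \<le> M" unfolding M by linarith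
  have "s\<^sup>2 / (2 * d) * h \<le> s\<^sup>2 / (2 * d) * (2 * d * s)"
    using h2 d by (intro mult_left_mono) auto
  moreover have "s\<^sup>2 / (2 * d) * (2 * d * s) = s ^ 3"
    using d by (simp add: field_simps power2_eq_square power3_eq_cube)
  moreover have "s ^ 4 / (16 * d) \<le> s ^ 3 / 4"
  proof -
    have "s ^ 4 \<le> s ^ 3" using s s1 by (intro power_decreasing) auto
    then show ?thesis using d s3 by (intro frac_le) auto
  qed
  ultimately have M2: "M \<le> N + 5 / 4 * s ^ 3" unfolding M by linarith
  have N0: "0 < N" using N1 d s2 by (smt (verit) mult_pos_pos)
  have M0: "0 < M" using N0 M1 s3 by linarith
  have s32: "s ^ 3 \<le> s\<^sup>2" using s s1 by (intro power_decreasing) auto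
  have "N \<le> 9 * d * s\<^sup>2" "M \<le> 9 * d * s\<^sup>2" using N2 M2 s32 ds s2 by linarith+
  then have R: "t * N \<le> 9 * d" "t * M \<le> 9 * d"
    using s2 by (simp_all add: t_def field_simps)
  define A where "A = exp (- (9 * d)) * t / (9 * d)"
  have A0: "0 \<le> A" using d t by (simp add: A_def)
  define \<phi> where "\<phi> = t * sqrt (ln (1 + N))"
  define \<psi> where "\<psi> = t * sqrt (ln (1 + M))"
  have dphi: "\<psi> - \<phi> = (sqrt (ln (1 + M)) - sqrt (ln (1 + N))) / s\<^sup>2"
    by (simp add: \<phi>_def \<psi>_def t_def diff_divide_distrib)
  have "1 / (24 * d) \<le> \<psi> - \<phi>" "\<psi> - \<phi> \<le> 1"
    using phase_increment_bounds[OF d s(1) _ N1 N2 M1 M2] s(2) unfolding dphi d_def by auto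
  moreover have "0 \<le> 1 / (24 * d)" using d by simp
  \<comment> \<open>The phase change is at most 1 <= pi / 2, where sine is still increasing.\<close>
  ultimately have "sin (1 / (24 * d)) \<le> sin (\<psi> - \<phi>)" "0 \<le> sin (1 / (24 * d))"
    using pi_ge_two by (intro sin_monotone_2pi_le sin_ge_zero; linarith)+
  then have "(sin (1 / (24 * d)))\<^sup>2 / 2 \<le> (sin (\<psi> - \<phi>))\<^sup>2 / 2"
    by (simp add: power_mono)
  also have "\<dots> \<le> (sin \<phi>)\<^sup>2 + (sin \<psi>)\<^sup>2" by (rule sin_squared_shift_ge)
  finally have "A * ((sin (1 / (24 * d)))\<^sup>2 / 2) \<le> A * (sin \<phi>)\<^sup>2 + A * (sin \<psi>)\<^sup>2"
    using A0 by (metis distrib_left mult_left_mono)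
  also have "A * (sin \<phi>)\<^sup>2 \<le> (1 + N) powr (- t) / ln (1 + N) * (sin \<phi>)\<^sup>2"
    unfolding A_def by (intro mult_right_mono damping_factor_ge N0 R t) auto
  also have "\<dots> = damped_oscillation t x"
    by (simp add: damped_oscillation_def N_def \<phi>_def)
  also have "A * (sin \<psi>)\<^sup>2 \<le> (1 + M) powr (- t) / ln (1 + M) * (sin \<psi>)\<^sup>2"
    unfolding A_def by (intro mult_right_mono damping_factor_ge M0 R t) auto
  also have "\<dots> = damped_oscillation t (v + x)"
    by (simp add: damped_oscillation_def M_def \<psi>_def)
  finally show ?thesis unfolding A_def t_def by simp
qed

text \<open>Integrating the pointwise bound over a cube of volume s^d gives order t s^d = t^(1 -
  d/2). The factor 2 counts the integrand and its translate; t >= 9 d is the condition 9 d s^2 <=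
  1.\<close>

lemma nn_integral_damped_oscillation_lower:
  assumes "2 \<le> DIM('a::euclidean_space)"
  shows "\<exists>C>0. \<forall>t\<ge>9 * real DIM('a).
    ennreal (C * t powr (- ((real DIM('a) - 2) / 2)))
      \<le> 2 * (\<integral>\<^sup>+x. ennreal (damped_oscillation t (x::'a)) \<partial>lborel)"
proof -
  define d where "d = real DIM('a)"
  have d: "2 \<le> d" using assms by (simp add: d_def)
  define C where "C = exp (- (9 * d)) / (9 * d) * ((sin (1 / (24 * d)))\<^sup>2 / 2)"
  have "1 / (24 * d) \<le> 1"
    using d by simp
  then have "1 / (24 * d) < pi"
    using pi_ge_two by linarith
  then have "0 < sin (1 / (24 * d))"
    using d by (intro sin_gt_zero) auto
  then have C: "0 < C" using d by (simp add: C_def)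
  moreover have "ennreal (C * t powr (- ((d - 2) / 2)))
      \<le> 2 * (\<integral>\<^sup>+x. ennreal (damped_oscillation t (x::'a)) \<partial>lborel)" if t: "9 * d \<le> t" for t
  proof -
    define s where "s = 1 / sqrt t"
    have t0: "0 < t" using t d by simp
    have s: "0 < s" and st: "1 / s\<^sup>2 = t" using t0 by (auto simp: s_def power_divide)
    have ss: "9 * real DIM('a) * s\<^sup>2 \<le> 1"
      using t t0 by (simp add: s_def power_divide d_def)
    define v :: 'a where "v = (s\<^sup>2 / (4 * real DIM('a))) *\<^sub>R One"
    define A :: "'a set" where "A = cbox (s *\<^sub>R One) ((2 * s) *\<^sub>R One)"
    have pt: "C * t \<le> damped_oscillation t x + damped_oscillation t (v + x)" if "x \<in> A" for x
      using damped_oscillation_shift_ge[OF assms s ss that[unfolded A_def] v_def]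
      by (simp add: C_def d_def st mult_ac)
    have pow: "t * s ^ DIM('a) = t powr (- ((d - 2) / 2))"
    proof -
      have "s = t powr (- 1 / 2)"
        using t0 by (simp add: s_def powr_minus_divide powr_half_sqrt)
      then have "s ^ DIM('a) = t powr (- 1 / 2 * d)"
        using s t0 by (simp add: powr_powr d_def flip: powr_realpow)
      then have "t * s ^ DIM('a) = t powr (1 + - 1 / 2 * d)"
        using t0 by (simp add: powr_mult_base)
      also have "1 + - 1 / 2 * d = - ((d - 2) / 2)" by (simp add: field_simps)
      finally show ?thesis .
    qed
    have "emeasure lborel A = ennreal (s ^ DIM('a))"
      using s by (simp add: A_def emeasure_lborel_cbox_eq flip: scaleR_left_diff_distrib)
    then have "ennreal (C * t * s ^ DIM('a)) = (\<integral>\<^sup>+x. ennreal (C * t) * indicator A x \<partial>lborel)"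
      using C t0 s by (subst nn_integral_cmult_indicator) (auto simp: A_def ennreal_mult)
    also have "\<dots> \<le> (\<integral>\<^sup>+x. ennreal (damped_oscillation t x) + ennreal (damped_oscillation t (v + x)) \<partial>lborel)"
    proof (rule nn_integral_mono)
      fix x :: 'a
      show "ennreal (C * t) * indicator A x
          \<le> ennreal (damped_oscillation t x) + ennreal (damped_oscillation t (v + x))"
        using pt[of x] by (auto simp: indicator_def damped_oscillation_nonneg ennreal_leI
            simp flip: ennreal_plus)
    qed
    also have "\<dots> = (\<integral>\<^sup>+x. ennreal (damped_oscillation t (x::'a)) \<partial>lborel)
        + (\<integral>\<^sup>+x. ennreal (damped_oscillation t (v + x)) \<partial>lborel)"
      by (intro nn_integral_add) auto
    \<comment> \<open>Translation invariance of Lebesgue measure, applied to the whole-space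
      integral.\<close>
    also have "(\<integral>\<^sup>+x. ennreal (damped_oscillation t (v + x)) \<partial>lborel)
        = (\<integral>\<^sup>+x. ennreal (damped_oscillation t x) \<partial>(distr lborel borel ((+) v)))"
      by (subst nn_integral_distr) auto
    also have "\<dots> = (\<integral>\<^sup>+x. ennreal (damped_oscillation t (x::'a)) \<partial>lborel)"
      by (simp only: lborel_distr_plus)
    finally show ?thesis by (simp add: pow mult.assoc mult_2)
  qed
  ultimately show ?thesis unfolding d_def by blast
qed

section \<open>Transfer to the Bochner integral\<close>

theorem proposition5p1:
  assumes "CARD('n::finite) \<ge> 3"
  shows "\<exists>t0>0. \<exists>C1>0. \<exists>C2>0. \<forall>t\<ge>t0.
    C1 * t powr (- ((real CARD('n) - 2) / 2))
      \<le> (LINT \<xi>::real^'n|lborel.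
            (1 + (norm \<xi>)\<^sup>2) powr (- t) * (sin (t * sqrt (ln (1 + (norm \<xi>)\<^sup>2))))\<^sup>2
              / ln (1 + (norm \<xi>)\<^sup>2))
    \<and> (LINT \<xi>::real^'n|lborel.
            (1 + (norm \<xi>)\<^sup>2) powr (- t) * (sin (t * sqrt (ln (1 + (norm \<xi>)\<^sup>2))))\<^sup>2
              / ln (1 + (norm \<xi>)\<^sup>2))
      \<le> C2 * t powr (- ((real CARD('n) - 2) / 2))"
proof -
  define d where "d = real CARD('n)"
  have d: "3 \<le> d" using assms by (simp add: d_def)
  define e where "e = - ((d - 2) / 2)"
  define I where "I t = (\<integral>\<^sup>+x. ennreal (damped_oscillation t (x::real^'n)) \<partial>lborel)" for t
  have int: "(LINT \<xi>::real^'n|lborel.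
            (1 + (norm \<xi>)\<^sup>2) powr (- t) * (sin (t * sqrt (ln (1 + (norm \<xi>)\<^sup>2))))\<^sup>2
              / ln (1 + (norm \<xi>)\<^sup>2)) = enn2real (I t)" for t
    unfolding damped_oscillation_def[symmetric] I_def
    by (intro integral_eq_nn_integral) (auto simp: damped_oscillation_nonneg)
  obtain C2 where C2: "0 < C2" "\<And>t. d + 1 \<le> t \<Longrightarrow> I t \<le> ennreal (C2 * t powr e)"
    using nn_integral_damped_oscillation_upper[where 'a = "real^'n"] assms
    unfolding I_def e_def d_def by auto
  obtain C1 where C1: "0 < C1" "\<And>t. 9 * d \<le> t \<Longrightarrow> ennreal (C1 * t powr e) \<le> 2 * I t"
    using nn_integral_damped_oscillation_lower[where 'a = "real^'n"] assms
    unfolding I_def e_def d_def by auto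
  \<comment> \<open>For d >= 3 the threshold 9 d also exceeds d + 1, so both bounds apply.\<close>
  have "C1 / 2 * t powr e \<le> enn2real (I t) \<and> enn2real (I t) \<le> C2 * t powr e" if t: "9 * d \<le> t" for t
  proof -
    \<comment> \<open>The upper bound comes first because it gives finiteness:
      \<open>enn2real\<close> sends infinity to 0, which would destroy the lower bound.\<close>
    have up: "I t \<le> ennreal (C2 * t powr e)" using C2(2) t d by simp
    then obtain r where r: "0 \<le> r" "I t = ennreal r"
      by (cases "I t") (auto simp: top_unique)
    have "ennreal (C1 * t powr e) \<le> ennreal (2 * r)"
      using C1(2)[OF t] r by (simp add: ennreal_mult)
    then show ?thesis using up r C1(1) C2(1) by (simp add: ennreal_le_iff)
  qed
  then show ?thesis
    unfolding int using C1(1) C2(1) d unfolding e_def d_def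
    by (intro exI[of _ "9 * real CARD('n)"] exI[of _ "C1 / 2"] exI[of _ C2] conjI) auto
qed

end
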